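(* For all $n\geq 1$, \[\mathrm{num}_{\mathcal B}(2n,x)=(1+x)^{2n}\,\mathrm{num}_{\mathcal B}(n,x^2)+f_{2n}(x)\,\mathrm{num}_{\mathcal B}(2n-2,x),\qquad\text{where } f_{2n}(x)=\prod_{i=1}^{\mathrm{val}_2(2n)}(1+x^{2^i}).\]
   Context: $\mathcal B(m)$ is the set of binary partitions of $m$ (all parts powers of $2$) and $m_\lambda(i)$ the number of parts of $\lambda$ equal to $i$. For $m\ge1$ and $\lambda\in\mathcal B(m)$ let $h_{\mathcal B,\lambda}(x)=\prod_{i=0}^{\lfloor\log_2 m\rfloor}(1+x^{2^i})^{\lfloor m/2^i\rfloor-m_\lambda(2^i)}$ and $\mathrm{num}_{\mathcal B}(m,x)=\sum_{\lambda\in\mathcal B(m)}h_{\mathcal B,\lambda}(x)$; set $\mathrm{num}_{\mathcal B}(0,x)=1$. $\mathrm{val}_2$ is the $2$-adic valuation. *)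

theory Defs
  imports
    Complex_Main
    "HOL-Library.Multiset"
    "HOL-Computational_Algebra.Polynomial"
    "HOL-Computational_Algebra.Primes"
begin

text \<open>Partitions are multisets of positive integers, so the number of parts of
  \<open>L\<close> equal to \<open>i\<close> is \<open>count L i\<close>.\<close>

definition binary_partitions :: "nat \<Rightarrow> nat multiset set" where
  "binary_partitions m = {L. (\<forall>p\<in>#L. \<exists>i. p = 2 ^ i) \<and> \<Sum>\<^sub># L = m}"

lemma finite_binary_partitions: "finite (binary_partitions m)"
proof -
  have sub: "binary_partitions m \<subseteq> mset ` {xs. set xs \<subseteq> {..m} \<and> length xs \<le> m}"
  proof
    fix L assume L: "L \<in> binary_partitions m"
    obtain xs where xs: "L = mset xs" by (metis ex_mset)
    have pos: "\<forall>p\<in>set xs. 1 \<le> p" and sum: "sum_list xs = m"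
      using L by (auto simp: binary_partitions_def xs sum_mset_sum_list)
    have "length xs \<le> sum_list xs"
      using pos by (induction xs) auto
    moreover have "set xs \<subseteq> {..m}"
      using sum member_le_sum_list by auto
    ultimately show "L \<in> mset ` {xs. set xs \<subseteq> {..m} \<and> length xs \<le> m}"
      using xs sum by auto
  qed
  show ?thesis
    by (rule finite_subset[OF sub]) (intro finite_imageI finite_lists_length_le, simp)
qed

text \<open>The subtraction of natural numbers in the exponent below is never truncated.\<close>

lemma count_binary_partitions_le:
  assumes "L \<in> binary_partitions m"
  shows "count L (2 ^ i) \<le> m div 2 ^ i"
proof -
  have "replicate_mset (count L (2 ^ i)) (2 ^ i) \<subseteq># L"
    by (simp flip: count_le_replicate_mset_subset_eq)
  then have "\<Sum>\<^sub># (replicate_mset (count L (2 ^ i)) (2 ^ i)) \<le> \<Sum>\<^sub># L"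
    by (metis le_add1 subset_mset.add_diff_inverse sum_mset.union)
  then have "count L (2 ^ i) * 2 ^ i \<le> m"
    using assms by (simp add: binary_partitions_def)
  then show ?thesis
    by (simp add: less_eq_div_iff_mult_less_eq)
qed

definition h_bin :: "nat \<Rightarrow> nat multiset \<Rightarrow> int poly" where
  "h_bin m L = (\<Prod>i = 0..nat \<lfloor>log 2 (real m)\<rfloor>.
     (1 + monom 1 (2 ^ i)) ^ (m div 2 ^ i - count L (2 ^ i)))"

definition num_bin :: "nat \<Rightarrow> int poly" where
  "num_bin m = (if m = 0 then 1 else \<Sum>L\<in>binary_partitions m. h_bin m L)"

definition f_bin :: "nat \<Rightarrow> int poly" where
  "f_bin m = (\<Prod>i = 1..multiplicity 2 m. 1 + monom 1 (2 ^ i))"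

end

theory Submission imports Defs begin

text \<open>The number of parts equal to 1 in a binary partition of \<open>2 n\<close> is even. The partitions
  without a part 1 are the doubled partitions of \<open>n\<close>; they contribute the first summand. The others
  arise by adding two parts 1 to a partition of \<open>2 n - 2\<close>: this leaves the exponent of
  \<open>1 + x\<close> in \<open>h\<close> unchanged, and for \<open>i \<ge> 1\<close> it raises the exponent of \<open>1 + x ^ 2 ^ i\<close> by one
  precisely if \<open>2 ^ i\<close> divides \<open>2 n\<close>, which gives the factor \<open>f\<close>.\<close>

text \<open>Factors beyond the logarithm have exponent 0, so one range serves all of
  \<open>2 n\<close>, \<open>2 n - 2\<close> and 0.\<close>

lemma h_bin_eq_prod:
  assumes "m < 2 ^ K"
  shows "h_bin m L = (\<Prod>i<K. (1 + monom 1 (2 ^ i)) ^ (m div 2 ^ i - count L (2 ^ i)))"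
proof -
  have big: "m div 2 ^ i = 0" if "i \<notin> {0..nat \<lfloor>log 2 (real m)\<rfloor>}" for i
  proof (cases "m = 0")
    case False
    have "log 2 (real m) < real i"
      using that by simp linarith
    then have "real m < 2 powr real i"
      using False by (simp add: log_less_iff)
    then have "real m < real (2 ^ i)"
      by (simp add: powr_realpow)
    then have "m < 2 ^ i"
      by (simp only: of_nat_less_iff)
    then show ?thesis
      by simp
  qed simp
  have "m div 2 ^ i = 0" if "\<not> i < K" for i
  proof -
    have "(2::nat) ^ K \<le> 2 ^ i"
      using that by (intro power_increasing) auto
    then have "m < 2 ^ i"
      using assms by linarith
    then show ?thesis
      by simp
  qed
  with big show ?thesis
    unfolding h_bin_def by (intro prod.mono_neutral_cong) auto
qed

text \<open>For \<open>n = 1\<close> the recurrence reaches \<open>num_bin 0\<close>; the value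
  fixed there agrees with the sum over the single empty partition.\<close>

lemma num_bin_eq_sum: "num_bin m = (\<Sum>L\<in>binary_partitions m. h_bin m L)"
proof (cases "m = 0")
  case True
  have "L = {#}" if "L \<in> binary_partitions 0" for L
    using that by (cases L) (auto simp: binary_partitions_def)
  then have "binary_partitions 0 = {{#}}"
    by (auto simp: binary_partitions_def)
  then show ?thesis
    \<comment> \<open>Every exponent is \<open>0 div 2 ^ i - 0 = 0\<close>, so the product is 1 over
      whatever range \<open>log 2 0\<close> yields.\<close>
    using True by (simp add: num_bin_def h_bin_def)
qed (simp add: num_bin_def)

text \<open>Gives \<open>f_bin\<close> the index range of \<open>h_bin_eq_prod\<close>, so that
  products can be compared factor by factor. The valuation of \<open>m\<close> lies below
  \<open>K\<close>.\<close>

lemma f_bin_eq_prod: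
  assumes "0 < m" "m < 2 ^ K"
  shows "f_bin m = (\<Prod>i<K. if 1 \<le> i \<and> 2 ^ i dvd m then 1 + monom 1 (2 ^ i) else 1)"
proof -
  have dvd_iff: "2 ^ i dvd m \<longleftrightarrow> i \<le> multiplicity 2 m" for i
    using assms(1) by (intro power_dvd_iff_le_multiplicity) auto
  have "2 ^ multiplicity 2 m \<le> m"
    using assms(1) by (intro dvd_imp_le multiplicity_dvd)
  then have "(2::nat) ^ multiplicity 2 m < 2 ^ K"
    using assms(2) by linarith
  then have "multiplicity 2 m < K"
    by simp
  then show ?thesis
    unfolding f_bin_def dvd_iff by (intro prod.mono_neutral_cong) auto
qed

lemma pcompose_monom_monom:
  "pcompose (monom 1 k) (monom (1 :: 'a :: comm_semiring_1) d) = monom 1 (d * k)"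
proof (induction k)
  case (Suc k)
  then show ?case
    by (simp add: monom_Suc pcompose_pCons mult_monom)
qed (simp add: one_pCons pcompose_pCons monom_0)

lemma pcompose_power:
  fixes p q :: "'a :: comm_semiring_1 poly"
  shows "pcompose (p ^ k) q = pcompose p q ^ k"
  by (induction k) (simp_all add: pcompose_mult pcompose_1)

text \<open>No doubled part is 1, so the factor at index 0 has the full exponent
  \<open>2 * n\<close>. The factor at \<open>i + 1\<close> is that of \<open>h_bin n M\<close> at
  \<open>i\<close> with x replaced by the square of x, since
  \<open>2 * n div 2 ^ (i + 1) = n div 2 ^ i\<close>.\<close>

lemma h_bin_double:
  "h_bin (2 * n) (image_mset ((*) 2) M) =
     (1 + monom 1 1) ^ (2 * n) * pcompose (h_bin n M) (monom 1 2)"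
proof -
  have lt: "n < 2 ^ n"
    by (rule less_exp)
  have c0: "count (image_mset ((*) 2) M) (Suc 0) = 0"
    by (induction M) auto
  have c: "count (image_mset ((*) 2) M) (2 * p) = count M p" for p :: nat
    by (induction M) auto
  \<comment> \<open>With \<open>Suc n\<close> factors here, splitting off index 0 leaves the range
    \<open>i<n\<close> that \<open>lt\<close> allows for \<open>h_bin n M\<close>.\<close>
  have "h_bin (2 * n) (image_mset ((*) 2) M) =
      (\<Prod>i<Suc n. (1 + monom 1 (2 ^ i)) ^
        (2 * n div 2 ^ i - count (image_mset ((*) 2) M) (2 ^ i)))"
    using lt by (intro h_bin_eq_prod) simp
  also have "\<dots> = (1 + monom 1 1) ^ (2 * n) *
      (\<Prod>i<n. (1 + monom 1 (2 * 2 ^ i)) ^ (n div 2 ^ i - count M (2 ^ i)))"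
    by (simp add: prod.lessThan_Suc_shift c c0 del: prod.lessThan_Suc)
  also have "(\<Prod>i<n. (1 + monom 1 (2 * 2 ^ i)) ^ (n div 2 ^ i - count M (2 ^ i))) =
      pcompose (h_bin n M) (monom 1 2)"
    by (simp add: h_bin_eq_prod[OF lt] pcompose_prod pcompose_power pcompose_add pcompose_1
        pcompose_monom_monom)
  finally show ?thesis .
qed

lemma h_bin_add_two_ones:
  assumes "1 \<le> n" "M \<in> binary_partitions (2 * n - 2)"
  shows "h_bin (2 * n) (M + {#1, 1#}) = f_bin (2 * n) * h_bin (2 * n - 2) M"
proof -
  let ?b = "\<lambda>i. 1 + monom 1 (2 ^ i) :: int poly"
  have lt: "2 * n < 2 ^ (2 * n)"
    by (rule less_exp)
  have factor: "?b i ^ (2 * n div 2 ^ i - count (M + {#1, 1#}) (2 ^ i)) =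
      (if 1 \<le> i \<and> 2 ^ i dvd 2 * n then ?b i else 1) *
      ?b i ^ ((2 * n - 2) div 2 ^ i - count M (2 ^ i))" for i
  proof (cases i)
    case 0
    \<comment> \<open>Minuend and count both grow by 2, so the exponent of \<open>1 + x\<close>
      stays the same.\<close>
    then show ?thesis by simp
  next
    case (Suc j)
    obtain k where k: "n = Suc k"
      using assms(1) by (cases n) auto
    have "2 * n div 2 ^ i = (2 * n - 2) div 2 ^ i + (if 2 ^ i dvd 2 * n then 1 else 0)"
    proof -
      \<comment> \<open>Halving turns \<open>2 * n - 2\<close> and \<open>2 * n\<close> into the
        consecutive numbers \<open>k\<close> and \<open>n\<close>, and a quotient grows by 1 exactly
        on reaching a multiple of the divisor.\<close>
      have "n div 2 ^ j = k div 2 ^ j + (if 2 ^ j dvd n then 1 else 0)"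
        unfolding k div_Suc dvd_eq_mod_eq_0 by simp
      moreover have "2 * n - 2 = 2 * k"
        using k by simp
      ultimately show ?thesis
        by (simp add: Suc)
    qed
    \<comment> \<open>Excludes truncated subtraction, so that a larger quotient does raise the
      exponent by one.\<close>
    moreover have "count M (2 ^ i) \<le> (2 * n - 2) div 2 ^ i"
      using assms(2) by (rule count_binary_partitions_le)
    moreover have "count (M + {#1, 1#}) (2 ^ i) = count M (2 ^ i)"
      by (simp add: Suc)
    ultimately show ?thesis
      by (simp add: Suc Suc_diff_le)
  qed
  have "h_bin (2 * n) (M + {#1, 1#}) =
      (\<Prod>i<2 * n. ?b i ^ (2 * n div 2 ^ i - count (M + {#1, 1#}) (2 ^ i)))"
    by (rule h_bin_eq_prod[OF lt])
  also have "\<dots> = f_bin (2 * n) * h_bin (2 * n - 2) M"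
  proof -
    have "2 * n - 2 < 2 ^ (2 * n)"
      using lt by linarith
    then show ?thesis
      using assms(1) lt by (simp only: factor prod.distrib f_bin_eq_prod h_bin_eq_prod)
  qed
  finally show ?thesis .
qed

lemma sum_mset_image_mult_left: "\<Sum>\<^sub># (image_mset ((*) (c::nat)) M) = c * \<Sum>\<^sub># M"
  by (induction M) (simp_all add: algebra_simps)

lemma even_sum_mset: "(\<And>p. p \<in># M \<Longrightarrow> even p) \<Longrightarrow> even (\<Sum>\<^sub># (M :: nat multiset))"
  by (induction M) auto

text \<open>A power of 2 other than 1 is twice a power of 2, so halving all parts undoes the
  doubling.\<close>

lemma binary_partitions_no_ones:
  "{L \<in> binary_partitions (2 * n). 1 \<notin># L} = image_mset ((*) 2) ` binary_partitions n"
proof (intro equalityI subsetI)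
  fix L assume "L \<in> {L \<in> binary_partitions (2 * n). 1 \<notin># L}"
  then have parts: "\<And>p. p \<in># L \<Longrightarrow> \<exists>i. p = 2 ^ i" and sum: "\<Sum>\<^sub># L = 2 * n" and "1 \<notin># L"
    by (auto simp: binary_partitions_def)
  have half: "\<exists>i. p = 2 * 2 ^ i" if p: "p \<in># L" for p
  proof -
    obtain i where "p = 2 ^ i"
      using parts p by blast
    with \<open>1 \<notin># L\<close> p show ?thesis
      by (cases i) auto
  qed
  define M where "M = image_mset (\<lambda>p. p div 2) L"
  have "image_mset ((*) 2) M = image_mset id L"
    unfolding M_def multiset.map_comp by (intro image_mset_cong) (auto dest: half)
  then have L: "L = image_mset ((*) 2) M"
    by simp
  have "\<Sum>\<^sub># M = n"
    using sum unfolding L sum_mset_image_mult_left by simp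
  moreover have "\<forall>p\<in>#M. \<exists>i. p = 2 ^ i"
    by (auto simp: M_def dest: half)
  ultimately have "M \<in> binary_partitions n"
    by (simp add: binary_partitions_def)
  with L show "L \<in> image_mset ((*) 2) ` binary_partitions n"
    by blast
next
  fix L assume "L \<in> image_mset ((*) 2) ` binary_partitions n"
  then obtain M where M: "M \<in> binary_partitions n" "L = image_mset ((*) 2) M"
    by blast
  have "\<exists>i. 2 * p = 2 ^ i" if "p \<in># M" for p
    using M(1) that by (auto simp: binary_partitions_def simp flip: power_Suc)
  then show "L \<in> {L \<in> binary_partitions (2 * n). 1 \<notin># L}"
    using M by (auto simp: binary_partitions_def sum_mset_image_mult_left)
qed

text \<open>All parts other than 1 are even and so is the total, hence a part 1 never occurs alone
  and two of them can be removed.\<close>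

lemma binary_partitions_ones:
  assumes "1 \<le> n"
  shows "{L \<in> binary_partitions (2 * n). 1 \<in># L} =
    (\<lambda>M. M + {#1, 1#}) ` binary_partitions (2 * n - 2)"
proof (intro equalityI subsetI)
  fix L assume "L \<in> {L \<in> binary_partitions (2 * n). 1 \<in># L}"
  then have parts: "\<And>p. p \<in># L \<Longrightarrow> \<exists>i. p = 2 ^ i" and sum: "\<Sum>\<^sub># L = 2 * n" and "1 \<in># L"
    by (auto simp: binary_partitions_def)
  then obtain M where M: "L = add_mset 1 M"
    by (meson multi_member_split)
  have "1 \<in># M"
  proof (rule ccontr)
    assume "1 \<notin># M"
    have "even p" if p: "p \<in># M" for p
    proof -
      obtain i where "p = 2 ^ i"
        using parts[of p] p by (auto simp: M)
      with \<open>1 \<notin># M\<close> p show ?thesis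
        by (cases i) auto
    qed
    then have "even (\<Sum>\<^sub># M)"
      by (rule even_sum_mset)
    moreover have "Suc (\<Sum>\<^sub># M) = 2 * n"
      using sum by (simp add: M)
    ultimately show False
      by presburger
  qed
  then obtain N where N: "M = add_mset 1 N"
    by (meson multi_member_split)
  have "N \<in> binary_partitions (2 * n - 2)"
    using parts sum by (auto simp: binary_partitions_def M N)
  then show "L \<in> (\<lambda>M. M + {#1, 1#}) ` binary_partitions (2 * n - 2)"
    by (auto simp: M N)
next
  fix L assume "L \<in> (\<lambda>M. M + {#1, 1#}) ` binary_partitions (2 * n - 2)"
  \<comment> \<open>The added parts are powers of 2 as well; \<open>Suc 0\<close> is the form that
    the simplifier gives to 1.\<close>
  moreover have "\<exists>i. Suc 0 = 2 ^ i"
    by (rule exI[of _ 0]) simp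
  ultimately show "L \<in> {L \<in> binary_partitions (2 * n). 1 \<in># L}"
    using assms by (auto simp: binary_partitions_def)
qed

theorem theorem4p12:
  fixes n :: nat
  assumes "n \<ge> 1"
  shows "num_bin (2 * n) =
    (1 + monom 1 1) ^ (2 * n) * pcompose (num_bin n) (monom 1 2)
      + f_bin (2 * n) * num_bin (2 * n - 2)"
proof -
  let ?B = "binary_partitions (2 * n)"
  \<comment> \<open>Halving every part is a left inverse.\<close>
  have inj2: "inj_on (image_mset ((*) (2::nat))) A" for A
    by (rule inj_on_inverseI[where g = "image_mset (\<lambda>p. p div 2)"])
      (simp add: multiset.map_comp comp_def)
  have inj1: "inj_on (\<lambda>M. M + {#1, 1#}) A" for A :: "nat multiset set"
    by (auto simp: inj_on_def)
  have "num_bin (2 * n) =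
      (\<Sum>L\<in>{L \<in> ?B. 1 \<notin># L} \<union> {L \<in> ?B. 1 \<in># L}. h_bin (2 * n) L)"
    unfolding num_bin_eq_sum by (intro sum.cong) auto
  also have "\<dots> = (\<Sum>L\<in>{L \<in> ?B. 1 \<notin># L}. h_bin (2 * n) L) +
      (\<Sum>L\<in>{L \<in> ?B. 1 \<in># L}. h_bin (2 * n) L)"
    by (intro sum.union_disjoint) (auto simp: finite_binary_partitions)
  also have "(\<Sum>L\<in>{L \<in> ?B. 1 \<notin># L}. h_bin (2 * n) L) =
      (1 + monom 1 1) ^ (2 * n) * pcompose (num_bin n) (monom 1 2)"
    unfolding binary_partitions_no_ones num_bin_eq_sum[of n]
    by (simp add: sum.reindex[OF inj2] h_bin_double pcompose_sum sum_distrib_left)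
  also have "(\<Sum>L\<in>{L \<in> ?B. 1 \<in># L}. h_bin (2 * n) L) = f_bin (2 * n) * num_bin (2 * n - 2)"
    unfolding binary_partitions_ones[OF assms] num_bin_eq_sum[of "2 * n - 2"]
      sum.reindex[OF inj1] sum_distrib_left comp_def
    by (intro sum.cong refl h_bin_add_two_ones assms)
  finally show ?thesis .
qed

end
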